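(* Consider the dynamic minimum-cost network flow problem $$\text{(F)}\qquad \begin{aligned}\min_{x_p\in\mathbb{R}_+,\,p\in\mathcal{P}}\ & \sum_{p\in\mathcal{P}} c_p x_p\\ \text{s.t. } & \sum_{p\in\mathcal{P}}\delta_{e=p_1}x_p=r_e^+ \ \text{ for } e\in\mathcal{S}^+,\qquad \sum_{p\in\mathcal{P}}\delta_{e=p_{\mathcal{T}}}x_p=r_e^- \ \text{ for } e\in\mathcal{S}^-,\\ & \sum_{p\in\mathcal{P}}\delta_{e=p_t}x_p\le d_e \ \text{ for } e\in\mathcal{E},\ t=2,\dots,\mathcal{T}-1,\end{aligned}$$ and the structured multi-marginal optimal transport problem $$\text{(OT)}\qquad \begin{aligned}\min_{\mathbf{M}\in\mathbb{R}_+^{n^{\mathcal{T}}}}\ & \langle\mathbf{C},\mathbf{M}\rangle\\ \text{s.t. } & P_1(\mathbf{M})=\mu_1,\quad P_{\mathcal{T}}(\mathbf{M})=\mu_{\mathcal{T}},\quad P_t(\mathbf{M})\le d \ \text{ for } t=2,\dots,\mathcal{T}-1,\end{aligned}$$ with all data as defined in the context. These problems correspond to each other in the following sense. 1. Assume that (OT) has a feasible solution with finite objective value. Then (OT) has a finite optimal value, and (F) has the same optimal value. Moreover, if $\mathbf{M}$ is an optimal solution of (OT), then there is an optimal solution $\{x_p : p\in\mathcal{P}\}$ of (F) such that $$(\ast)\qquad \mathbf{M}_{i_1\dots i_{\mathcal{T}}}=\begin{cases}x_p & \text{for } (i_1,\dots,i_{\mathcal{T}})\in\mathcal{P},\ \text{where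 } p=(i_1,\dots,i_{\mathcal{T}}),\\ 0 & \text{for } (i_1,\dots,i_{\mathcal{T}})\in\tilde{\mathcal{P}}\setminus\mathcal{P}.\end{cases}$$ 2. Assume that there is a feasible solution to (F). Then (F) has a finite optimal value, and (OT) has the same optimal value. Moreover, if $\{x_p : p\in\mathcal{P}\}$ is an optimal solution of (F), then there is an optimal solution $\mathbf{M}$ of (OT) such that $(\ast)$ holds.
   Context: $\mathcal{N}=(\mathcal{V},\mathcal{E})$ is a finite directed network with $n=|\mathcal{E}|$ edges, and $\mathcal{T}\ge 2$ is an integer number of time steps. Sources $\mathcal{S}^+\subset\mathcal{E}$ and sinks $\mathcal{S}^-\subset\mathcal{E}$ are sets of edges, with supplies $r_e^+\in\mathbb{R}_+$ ($e\in\mathcal{S}^+$) and demands $r_e^-\in\mathbb{R}_+$ ($e\in\mathcal{S}^-$) satisfying $\sum_{e\in\mathcal{S}^+}r_e^+=\sum_{e\in\mathcal{S}^-}r_e^-$. Each edge $e$ has a unit cost $c_e\in\mathbb{R}_+$ and a capacity $d_e\in\mathbb{R}_+$; write $c=(c_e)_e$ and $d=(d_e)_e\in\mathbb{R}_+^n$. Here $\mathbb{R}_+$ denotes the nonnegative reals, and $\overline{\mathbb{R}}_+=\mathbb{R}_+\cup\{\infty\}$, with the convention $0\cdot\infty=0$. The time-expanded network has vertices $(t,v)$ for $t=0,\dots,\mathcal{T}$, $v\in\mathcal{V}$, and edges $\mathcal{E}_t=\{((t-1,v),(t,w)) : (v,w)\in\mathcal{E}\}$, $t=1,\dots,\mathcal{T}$;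 each $\mathcal{E}_t$ is canonically identified with $\mathcal{E}$, with the same costs and capacities. $\tilde{\mathcal{P}}=\{(i_1,\dots,i_{\mathcal{T}}) : i_t\in\mathcal{E}_t,\ t=1,\dots,\mathcal{T}\}$ is the set of all tuples of edges, and $\mathcal{P}\subset\tilde{\mathcal{P}}$ is the set of feasible paths: tuples $p=(p_1,\dots,p_{\mathcal{T}})$ forming a path in the time-expanded network (i.e. the head of $p_t$ is the tail of $p_{t+1}$ for all $t=1,\dots,\mathcal{T}-1$) with $p_1\in\mathcal{S}^+$ and $p_{\mathcal{T}}\in\mathcal{S}^-$. The path cost is $c_p=\sum_{t=1}^{\mathcal{T}}c_{p_t}$. $\delta_{e=p_t}$ equals $1$ if $e=p_t$ and $0$ otherwise. For a tensor $\mathbf{M}\in\mathbb{R}_+^{n^{\mathcal{T}}}=\mathbb{R}_+^{n\times\cdots\times n}$ ($\mathcal{T}$ modes, each indexed by $\mathcal{E}$), the projection on the $t$-th marginal is $(P_t(\mathbf{M}))_{i_t}=\sum_{i_1,\dots,i_{t-1},i_{t+1},\dots,i_{\mathcal{T}}}\mathbf{M}_{i_1\dots i_{\mathcal{T}}}$, and $\langle\mathbf{C},\mathbf{M}\rangle=\sum_{i_1,\dots,i_{\mathcal{T}}}\mathbf{C}_{i_1\dots i_{\mathcal{T}}}\mathbf{M}_{i_1\dots i_{\mathcal{T}}}$. The matrix $C\in\overline{\mathbb{R}}_+^{n\times n}$ encodes the network topology: $C_{ij}=0$ if edge $i$ leads to edge $j$ (the second vertex of $i$ is the first vertex of $j$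 in $\mathcal{N}$), and $C_{ij}=\infty$ otherwise. The cost tensor is $$\mathbf{C}_{i_1\dots i_{\mathcal{T}}}=\sum_{t=1}^{\mathcal{T}}c_{i_t}+\sum_{t=1}^{\mathcal{T}-1}C_{i_ti_{t+1}}.$$ The vectors $\mu_1,\mu_{\mathcal{T}}\in\mathbb{R}_+^n$ are defined by $(\mu_1)_i=r_i^+$ for $i\in\mathcal{S}^+$ and $0$ otherwise, and $(\mu_{\mathcal{T}})_i=r_i^-$ for $i\in\mathcal{S}^-$ and $0$ otherwise. Vector inequalities are elementwise. *)

theory Defs
  imports "HOL-Analysis.Analysis" "Graph_Theory.Pair_Digraph"
begin

text \<open>
  A finite directed network is a \<^locale>\<open>pair_fin_digraph\<close>: its edges are pairs of vertices, and
  self-loops are allowed. Every layer of the time-expanded network is identified with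
  \<open>parcs N\<close>; \<open>time_arc t e\<close> is the copy of the edge \<open>e\<close> that leads from time \<open>t - 1\<close> to time \<open>t\<close>.
  A tuple of edges is an extensional function on the index set \<open>{1..T}\<close>.
\<close>

definition time_arc :: "nat \<Rightarrow> 'v \<times> 'v \<Rightarrow> (nat \<times> 'v) \<times> (nat \<times> 'v)" where
  "time_arc t e = ((t - 1, fst e), (t, snd e))"

definition arc_tuples :: "'v pair_pre_digraph \<Rightarrow> nat \<Rightarrow> (nat \<Rightarrow> 'v \<times> 'v) set" where
  "arc_tuples N T = PiE {1..T} (\<lambda>_. parcs N)"

definition feasible_paths ::
  "'v pair_pre_digraph \<Rightarrow> nat \<Rightarrow> ('v \<times> 'v) set \<Rightarrow> ('v \<times> 'v) set \<Rightarrow> (nat \<Rightarrow> 'v \<times> 'v) set" where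
  "feasible_paths N T Src Snk = {p \<in> arc_tuples N T.
     (\<forall>t\<in>{1..T - 1}. snd (time_arc t (p t)) = fst (time_arc (t + 1) (p (t + 1)))) \<and>
     p 1 \<in> Src \<and> p T \<in> Snk}"

definition path_cost :: "nat \<Rightarrow> ('v \<times> 'v \<Rightarrow> real) \<Rightarrow> (nat \<Rightarrow> 'v \<times> 'v) \<Rightarrow> real" where
  "path_cost T c p = (\<Sum>t = 1..T. c (p t))"


text \<open>
  Only the values of \<open>x\<close> on \<open>feasible_paths N T Src Snk\<close> matter.
\<close>

definition flow_cost ::
  "'v pair_pre_digraph \<Rightarrow> nat \<Rightarrow> ('v \<times> 'v) set \<Rightarrow> ('v \<times> 'v) set \<Rightarrow> ('v \<times> 'v \<Rightarrow> real) \<Rightarrow>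
   ((nat \<Rightarrow> 'v \<times> 'v) \<Rightarrow> real) \<Rightarrow> real" where
  "flow_cost N T Src Snk c x = (\<Sum>p\<in>feasible_paths N T Src Snk. path_cost T c p * x p)"

definition flow_feasible ::
  "'v pair_pre_digraph \<Rightarrow> nat \<Rightarrow> ('v \<times> 'v) set \<Rightarrow> ('v \<times> 'v) set \<Rightarrow>
   ('v \<times> 'v \<Rightarrow> real) \<Rightarrow> ('v \<times> 'v \<Rightarrow> real) \<Rightarrow> ('v \<times> 'v \<Rightarrow> real) \<Rightarrow>
   ((nat \<Rightarrow> 'v \<times> 'v) \<Rightarrow> real) \<Rightarrow> bool" where
  "flow_feasible N T Src Snk rsrc rsnk d x \<longleftrightarrow>
     (\<forall>p\<in>feasible_paths N T Src Snk. 0 \<le> x p) \<and>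
     (\<forall>e\<in>Src. (\<Sum>p\<in>feasible_paths N T Src Snk. of_bool (e = p 1) * x p) = rsrc e) \<and>
     (\<forall>e\<in>Snk. (\<Sum>p\<in>feasible_paths N T Src Snk. of_bool (e = p T) * x p) = rsnk e) \<and>
     (\<forall>e\<in>parcs N. \<forall>t\<in>{2..T - 1}.
        (\<Sum>p\<in>feasible_paths N T Src Snk. of_bool (e = p t) * x p) \<le> d e)"


text \<open>
  Only the values of a tensor on \<open>arc_tuples N T\<close> matter.
  In \<^typ>\<open>ereal\<close>, the convention \<open>0 * \<infinity> = 0\<close> holds.
\<close>

definition marginal ::
  "'v pair_pre_digraph \<Rightarrow> nat \<Rightarrow> nat \<Rightarrow> ((nat \<Rightarrow> 'v \<times> 'v) \<Rightarrow> real) \<Rightarrow> 'v \<times> 'v \<Rightarrow> real" where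
  "marginal N T t M e = (\<Sum>i\<in>{i \<in> arc_tuples N T. i t = e}. M i)"

definition topology_cost :: "'v \<times> 'v \<Rightarrow> 'v \<times> 'v \<Rightarrow> ereal" where
  "topology_cost i j = (if snd i = fst j then 0 else \<infinity>)"

definition cost_tensor :: "nat \<Rightarrow> ('v \<times> 'v \<Rightarrow> real) \<Rightarrow> (nat \<Rightarrow> 'v \<times> 'v) \<Rightarrow> ereal" where
  "cost_tensor T c i =
     (\<Sum>t = 1..T. ereal (c (i t))) + (\<Sum>t = 1..T - 1. topology_cost (i t) (i (t + 1)))"

definition transport_cost ::
  "'v pair_pre_digraph \<Rightarrow> nat \<Rightarrow> ('v \<times> 'v \<Rightarrow> real) \<Rightarrow> ((nat \<Rightarrow> 'v \<times> 'v) \<Rightarrow> real) \<Rightarrow> ereal" where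
  "transport_cost N T c M = (\<Sum>i\<in>arc_tuples N T. cost_tensor T c i * ereal (M i))"

definition extend_by_zero :: "('v \<times> 'v) set \<Rightarrow> ('v \<times> 'v \<Rightarrow> real) \<Rightarrow> 'v \<times> 'v \<Rightarrow> real" where
  "extend_by_zero S r e = (if e \<in> S then r e else 0)"

definition transport_feasible ::
  "'v pair_pre_digraph \<Rightarrow> nat \<Rightarrow> ('v \<times> 'v) set \<Rightarrow> ('v \<times> 'v) set \<Rightarrow>
   ('v \<times> 'v \<Rightarrow> real) \<Rightarrow> ('v \<times> 'v \<Rightarrow> real) \<Rightarrow> ('v \<times> 'v \<Rightarrow> real) \<Rightarrow>
   ((nat \<Rightarrow> 'v \<times> 'v) \<Rightarrow> real) \<Rightarrow> bool" where
  "transport_feasible N T Src Snk rsrc rsnk d M \<longleftrightarrow>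
     (\<forall>i\<in>arc_tuples N T. 0 \<le> M i) \<and>
     (\<forall>e\<in>parcs N. marginal N T 1 M e = extend_by_zero Src rsrc e) \<and>
     (\<forall>e\<in>parcs N. marginal N T T M e = extend_by_zero Snk rsnk e) \<and>
     (\<forall>t\<in>{2..T - 1}. \<forall>e\<in>parcs N. marginal N T t M e \<le> d e)"

definition tensor_of_flow ::
  "'v pair_pre_digraph \<Rightarrow> nat \<Rightarrow> ('v \<times> 'v) set \<Rightarrow> ('v \<times> 'v) set \<Rightarrow>
   ((nat \<Rightarrow> 'v \<times> 'v) \<Rightarrow> real) \<Rightarrow> ((nat \<Rightarrow> 'v \<times> 'v) \<Rightarrow> real) \<Rightarrow> bool" where
  "tensor_of_flow N T Src Snk M x \<longleftrightarrow>
     (\<forall>i\<in>arc_tuples N T. M i = (if i \<in> feasible_paths N T Src Snk then x i else 0))"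


text \<open>
  The optimal value of a minimization problem is its minimum, so it is attained; optimal
  solutions are the minimizers in the sense of \<^const>\<open>is_arg_min\<close>.
\<close>

definition has_optimal_value :: "('a \<Rightarrow> 'b::linorder) \<Rightarrow> ('a \<Rightarrow> bool) \<Rightarrow> 'b \<Rightarrow> bool" where
  "has_optimal_value f feas v \<longleftrightarrow> (\<exists>x. is_arg_min f feas x \<and> f x = v)"

end

theory Submission
  imports Defs
begin

text \<open>
  A tensor of finite cost that satisfies the two end marginals vanishes off the feasible paths,
  and on tensors that vanish there the constraints and costs of both problems coincide. So the two
  problems have the same minimizers as soon as one minimizer exists. The flow problem attains its
  minimum by compactness: the source constraints fix the total mass of a flow.
\<close>

text \<open>The canonical tensor of a flow. Flows and tensors share one function type, so the same
  map also normalizes a flow to vanish off the feasible paths.\<close>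

definition tensor_extension ::
  "'v pair_pre_digraph \<Rightarrow> nat \<Rightarrow> ('v \<times> 'v) set \<Rightarrow> ('v \<times> 'v) set \<Rightarrow>
   ((nat \<Rightarrow> 'v \<times> 'v) \<Rightarrow> real) \<Rightarrow> (nat \<Rightarrow> 'v \<times> 'v) \<Rightarrow> real" where
  "tensor_extension N T Src Snk x i = (if i \<in> feasible_paths N T Src Snk then x i else 0)"

lemma tensor_of_flow_tensor_extension:
  "tensor_of_flow N T Src Snk (tensor_extension N T Src Snk x) x"
  by (simp add: tensor_of_flow_def tensor_extension_def)

section \<open>Feasible paths and the finite and infinite entries of the cost tensor\<close>

lemma feasible_paths_subset: "feasible_paths N T Src Snk \<subseteq> arc_tuples N T"
  by (auto simp: feasible_paths_def)

lemma feasible_pathsD: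
  assumes "p \<in> feasible_paths N T Src Snk"
  shows "p 1 \<in> Src" "p T \<in> Snk" "t \<in> {1..T - 1} \<Longrightarrow> snd (p t) = fst (p (t + 1))"
  using assms by (auto simp: feasible_paths_def time_arc_def)

lemma cost_tensor_feasible_path:
  assumes "p \<in> feasible_paths N T Src Snk"
  shows "cost_tensor T c p = ereal (path_cost T c p)"
proof -
  have "(\<Sum>t = 1..T - 1. topology_cost (p t) (p (t + 1))) = 0"
    by (rule sum.neutral) (use feasible_pathsD(3)[OF assms] in \<open>auto simp: topology_cost_def\<close>)
  then show ?thesis
    by (simp add: cost_tensor_def path_cost_def)
qed

lemma cost_tensor_disconnected:
  assumes "t \<in> {1..T - 1}" "snd (i t) \<noteq> fst (i (t + 1))"
  shows "cost_tensor T c i = \<infinity>"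
proof -
  have "topology_cost (i t) (i (t + 1)) = \<infinity>"
    using assms(2) by (simp add: topology_cost_def)
  then have "(\<Sum>t = 1..T - 1. topology_cost (i t) (i (t + 1))) = \<infinity>"
    using assms(1) by (force simp: sum_Pinfty)
  then show ?thesis
    by (simp add: cost_tensor_def)
qed

locale transport_network = pair_fin_digraph N
  for N :: "'v pair_pre_digraph" +
  fixes T :: nat
    and Src Snk :: "('v \<times> 'v) set"
    and rsrc rsnk c d :: "'v \<times> 'v \<Rightarrow> real"
  assumes T_pos: "1 \<le> T"
    and Src_subset: "Src \<subseteq> parcs N"
    and Snk_subset: "Snk \<subseteq> parcs N"
begin

abbreviation "paths \<equiv> feasible_paths N T Src Snk"
abbreviation "flow_feas \<equiv> flow_feasible N T Src Snk rsrc rsnk d"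
abbreviation "flow_obj \<equiv> flow_cost N T Src Snk c"
abbreviation "transport_feas \<equiv> transport_feasible N T Src Snk rsrc rsnk d"
abbreviation "transport_obj \<equiv> transport_cost N T c"
abbreviation "corresponds \<equiv> tensor_of_flow N T Src Snk"

section \<open>Constraints and costs of corresponding tensors and flows\<close>

lemma finite_arc_tuples: "finite (arc_tuples N T)"
  unfolding arc_tuples_def by (intro finite_PiE) auto

lemma finite_paths: "finite paths"
  using finite_arc_tuples feasible_paths_subset by (rule finite_subset[rotated])

lemma marginal_corresponds:
  assumes "corresponds M x"
  shows "marginal N T t M e = (\<Sum>p\<in>paths. of_bool (e = p t) * x p)"
proof -
  have "marginal N T t M e = (\<Sum>i\<in>arc_tuples N T. of_bool (e = i t) * M i)"
    unfolding marginal_def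
    by (rule sum.mono_neutral_cong_left) (auto simp: finite_arc_tuples)
  also have "\<dots> = (\<Sum>p\<in>paths. of_bool (e = p t) * x p)"
    using assms feasible_paths_subset[of N T Src Snk]
    by (intro sum.mono_neutral_cong_right)
      (auto simp: finite_arc_tuples tensor_of_flow_def split: if_splits)
  finally show ?thesis .
qed

text \<open>The flow problem prescribes end loads only on \<open>Src\<close> and \<open>Snk\<close>,
  the transport problem on all arcs. The extra equations hold automatically: every feasible path
  starts in \<open>Src\<close> and ends in \<open>Snk\<close>, so the end loads elsewhere are 0, as
  \<open>extend_by_zero\<close> demands.\<close>

lemma feasible_corresponds_iff:
  assumes "corresponds M x"
  shows "transport_feas M \<longleftrightarrow> flow_feas x"
proof -
  have nonneg: "(\<forall>i\<in>arc_tuples N T. 0 \<le> M i) \<longleftrightarrow> (\<forall>p\<in>paths. 0 \<le> x p)"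
    using assms feasible_paths_subset[of N T Src Snk] by (force simp: tensor_of_flow_def)
  have src: "(\<Sum>p\<in>paths. of_bool (e = p 1) * x p) = 0" if "e \<notin> Src" for e
    by (rule sum.neutral) (use that in \<open>auto dest: feasible_pathsD(1)\<close>)
  have snk: "(\<Sum>p\<in>paths. of_bool (e = p T) * x p) = 0" if "e \<notin> Snk" for e
    by (rule sum.neutral) (use that in \<open>auto dest: feasible_pathsD(2)\<close>)
  have extend: "(\<forall>e\<in>parcs N. f e = extend_by_zero S r e) \<longleftrightarrow> (\<forall>e\<in>S. f e = r e)"
    if "S \<subseteq> parcs N" "\<And>e. e \<notin> S \<Longrightarrow> f e = 0" for f r S
    using that by (auto simp: extend_by_zero_def)
  show ?thesis
    unfolding transport_feasible_def flow_feasible_def nonneg marginal_corresponds[OF assms]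
    by (subst extend[OF Src_subset src], assumption, subst extend[OF Snk_subset snk], assumption) blast
qed

text \<open>Infinite entries of the cost tensor occur only off the feasible paths, where
  \<open>M\<close> is 0 and the convention \<open>0 * \<infinity> = 0\<close> removes them.\<close>

lemma cost_corresponds:
  assumes "corresponds M x"
  shows "transport_obj M = ereal (flow_obj x)"
proof -
  have "transport_obj M = (\<Sum>p\<in>paths. ereal (path_cost T c p * x p))"
    unfolding transport_cost_def
    using assms feasible_paths_subset[of N T Src Snk]
    by (intro sum.mono_neutral_cong_right)
      (auto simp: finite_arc_tuples tensor_of_flow_def cost_tensor_feasible_path zero_ereal_def[symmetric])
  then show ?thesis
    by (simp add: flow_cost_def)
qed

lemma marginal_eq_0D:
  assumes "\<And>i. i \<in> arc_tuples N T \<Longrightarrow> 0 \<le> M i" "marginal N T t M (i t) = 0" "i \<in> arc_tuples N T"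
  shows "M i = 0"
proof -
  have "\<forall>j\<in>{j \<in> arc_tuples N T. j t = i t}. M j = 0"
    using assms(1,2) unfolding marginal_def
    by (subst (asm) sum_nonneg_eq_0_iff) (auto simp: finite_arc_tuples)
  then show ?thesis
    using assms(3) by simp
qed

text \<open>Conclusion \<open>corresponds M M\<close> encodes that \<open>M\<close> vanishes off the
  feasible paths; \<open>M\<close> then serves as its own flow.\<close>

lemma finite_cost_corresponds:
  assumes feas: "transport_feas M" and fin: "transport_obj M \<noteq> \<infinity>"
  shows "corresponds M M"
proof -
  have nonneg: "0 \<le> M i" if "i \<in> arc_tuples N T" for i
    using feas that by (simp add: transport_feasible_def)
  have "M i = 0" if i: "i \<in> arc_tuples N T" "i \<notin> paths" for i
  proof -
    have arcs: "i t \<in> parcs N" if "t \<in> {1..T}" for t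
      using i(1) that unfolding arc_tuples_def by (rule PiE_mem)
    \<comment> \<open>The end marginals exclude the first two defects, the finite cost excludes the
      third.\<close>
    consider "i 1 \<notin> Src" | "i T \<notin> Snk"
      | t where "t \<in> {1..T - 1}" "snd (i t) \<noteq> fst (i (t + 1))"
      using i by (auto simp: feasible_paths_def time_arc_def)
    then show ?thesis
    proof cases
      case 1
      then have "marginal N T 1 M (i 1) = 0"
        using feas arcs T_pos by (simp add: transport_feasible_def extend_by_zero_def)
      then show ?thesis
        using marginal_eq_0D nonneg i(1) by blast
    next
      case 2
      then have "marginal N T T M (i T) = 0"
        using feas arcs T_pos by (simp add: transport_feasible_def extend_by_zero_def)
      then show ?thesis
        using marginal_eq_0D nonneg i(1) by blast
    next
      case 3
      then have inf: "cost_tensor T c i = \<infinity>"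
        by (rule cost_tensor_disconnected)
      \<comment> \<open>A finite \<open>ereal\<close> sum is \<open>\<infinity>\<close> as soon as
        one term is, so a positive \<open>M i\<close> would make the whole cost infinite.\<close>
      have "cost_tensor T c i * ereal (M i) \<noteq> \<infinity>"
        using fin i(1) by (auto simp: transport_cost_def sum_Pinfty finite_arc_tuples)
      then show ?thesis
        using nonneg[OF i(1)] by (auto simp: inf split: if_splits)
    qed
  qed
  then show ?thesis
    by (auto simp: tensor_of_flow_def)
qed

section \<open>Existence of a minimal flow\<close>

text \<open>Each path has exactly one first arc, and it lies in \<open>Src\<close>. Summing the
  source constraints therefore counts every path once and gives the total mass, which dominates each
  single term.\<close>

lemma flow_le_total_supply:
  assumes "flow_feas x" "p \<in> paths"
  shows "x p \<le> (\<Sum>e\<in>Src. rsrc e)"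
proof -
  have fin: "finite Src"
    using Src_subset by (rule finite_subset) simp
  have "(\<Sum>e\<in>Src. rsrc e) = (\<Sum>e\<in>Src. \<Sum>q\<in>paths. of_bool (e = q 1) * x q)"
    using assms(1) by (simp add: flow_feasible_def)
  also have "\<dots> = (\<Sum>q\<in>paths. \<Sum>e\<in>Src. of_bool (e = q 1) * x q)"
    by (rule sum.swap)
  also have "\<dots> = (\<Sum>q\<in>paths. x q)"
  proof (rule sum.cong[OF refl])
    fix q assume "q \<in> paths"
    then have "q 1 \<in> Src"
      by (rule feasible_pathsD(1))
    then show "(\<Sum>e\<in>Src. of_bool (e = q 1) * x q) = x q"
      using fin by (simp add: sum_distrib_right[symmetric] of_bool_def)
  qed
  also have "x p \<le> (\<Sum>q\<in>paths. x q)"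
    using assms finite_paths by (intro member_le_sum) (auto simp: flow_feasible_def)
  finally show ?thesis .
qed

text \<open>In the product topology on functions, each constraint is an equation or a weak
  inequality between continuous functions of \<open>x\<close>.\<close>

lemma closed_flow_feasible: "closed {x. flow_feas x}"
proof -
  have coord: "continuous_on UNIV (\<lambda>x. x p)" for p :: "nat \<Rightarrow> 'v \<times> 'v"
    by (rule continuous_on_product_coordinates)
  have load: "continuous_on UNIV (\<lambda>x. \<Sum>p\<in>paths. of_bool (e = p t) * x p :: real)" for e t
    by (rule continuous_on_sum, rule continuous_on_mult_left, rule coord)
  have "{x. flow_feas x} = (\<Inter>p\<in>paths. {x. 0 \<le> x p}) \<inter>
      (\<Inter>e\<in>Src. {x. (\<Sum>p\<in>paths. of_bool (e = p 1) * x p) = rsrc e}) \<inter>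
      (\<Inter>e\<in>Snk. {x. (\<Sum>p\<in>paths. of_bool (e = p T) * x p) = rsnk e}) \<inter>
      (\<Inter>e\<in>parcs N. \<Inter>t\<in>{2..T - 1}. {x. (\<Sum>p\<in>paths. of_bool (e = p t) * x p) \<le> d e})"
    unfolding flow_feasible_def by blast
  also have "closed \<dots>"
    by (intro closed_Int closed_INT ballI closed_Collect_le closed_Collect_eq load coord
        continuous_on_const)
  finally show ?thesis .
qed

text \<open>
  Flows are unconstrained off \<open>paths\<close>; setting them to zero there makes the domain compact.
\<close>

lemma flow_minimizer_exists:
  assumes "flow_feas x0"
  shows "\<exists>x. is_arg_min flow_obj flow_feas x"
proof -
  let ?R = "\<Sum>e\<in>Src. rsrc e"
  let ?B = "PiE UNIV (\<lambda>p. if p \<in> paths then {0..?R} else {0::real})"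
  let ?K = "?B \<inter> {x. flow_feas x}"
  let ?cut = "tensor_extension N T Src Snk"
  have cut_feas: "flow_feas (?cut x) \<longleftrightarrow> flow_feas x" for x
    by (simp add: flow_feasible_def tensor_extension_def cong: sum.cong ball_cong)
  have cut_cost: "flow_obj (?cut x) = flow_obj x" for x
    by (simp add: flow_cost_def tensor_extension_def)
  have cut_mem: "?cut x \<in> ?K" if "flow_feas x" for x
    using that flow_le_total_supply[OF that] cut_feas
    by (auto simp: tensor_extension_def flow_feasible_def)
  \<comment> \<open>Tychonoff: \<open>?B\<close> is a product of compact intervals and
    singletons.\<close>
  have "compact ?B"
    by (subst compactin_euclidean_iff[symmetric], subst euclidean_product_topology[symmetric],
        subst compactin_PiE) auto
  then have "compact ?K"
    using closed_flow_feasible by (rule compact_Int_closed)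
  moreover have "?K \<noteq> {}"
    using cut_mem[OF assms] by blast
  moreover have "continuous_on ?K flow_obj"
    unfolding flow_cost_def 
    by (intro continuous_intros continuous_on_subset[OF continuous_on_product_coordinates]) auto
  ultimately obtain x where x: "x \<in> ?K" "\<And>y. y \<in> ?K \<Longrightarrow> flow_obj x \<le> flow_obj y"
    using continuous_attains_inf by metis
  \<comment> \<open>Competitors outside \<open>?K\<close> are compared through
    \<open>?cut y\<close>, which lies in \<open>?K\<close> and has the same cost.\<close>
  have "flow_obj x \<le> flow_obj y" if "flow_feas y" for y
    using x(2)[OF cut_mem[OF that]] by (simp add: cut_cost)
  then show ?thesis
    using x(1) by (auto simp: is_arg_min_linorder)
qed

section \<open>Transfer of minimizers\<close>

text \<open>A competing tensor of infinite cost is harmless; one of finite cost is itself a feasible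
  flow of the same cost.\<close>

lemma transport_minimizer_if_flow_minimizer:
  assumes opt: "is_arg_min flow_obj flow_feas x" and corr: "corresponds M x"
  shows "is_arg_min transport_obj transport_feas M"
proof -
  have "transport_obj M \<le> transport_obj M'" if M': "transport_feas M'" for M'
  proof (cases "transport_obj M' = \<infinity>")
    case False
    then have corr': "corresponds M' M'"
      using M' finite_cost_corresponds by blast
    then have "flow_obj x \<le> flow_obj M'"
      using opt M' feasible_corresponds_iff by (auto simp: is_arg_min_linorder)
    then show ?thesis
      using cost_corresponds[OF corr] cost_corresponds[OF corr'] by simp
  qed simp
  then show ?thesis
    using opt feasible_corresponds_iff[OF corr] by (auto simp: is_arg_min_linorder)
qed

text \<open>Each competing flow extends by zero to a feasible tensor of the same cost, which
  \<open>M\<close> does not exceed.\<close>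

lemma flow_minimizer_if_transport_minimizer:
  assumes opt: "is_arg_min transport_obj transport_feas M" and corr: "corresponds M x"
  shows "is_arg_min flow_obj flow_feas x"
proof -
  have "flow_obj x \<le> flow_obj y" if y: "flow_feas y" for y
  proof -
    let ?M = "tensor_extension N T Src Snk y"
    have corr': "corresponds ?M y"
      by (rule tensor_of_flow_tensor_extension)
    then have "transport_obj M \<le> transport_obj ?M"
      using opt y feasible_corresponds_iff by (auto simp: is_arg_min_linorder)
    then show ?thesis
      using cost_corresponds[OF corr] cost_corresponds[OF corr'] by simp
  qed
  then show ?thesis
    using opt feasible_corresponds_iff[OF corr] by (auto simp: is_arg_min_linorder)
qed

lemma common_optimal_value:
  assumes "flow_feas x0"
  shows "\<exists>v::real. has_optimal_value transport_obj transport_feas (ereal v) \<and>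
    has_optimal_value flow_obj flow_feas v"
proof -
  obtain x where x: "is_arg_min flow_obj flow_feas x"
    using flow_minimizer_exists[OF assms] by blast
  have corr: "corresponds (tensor_extension N T Src Snk x) x"
    by (rule tensor_of_flow_tensor_extension)
  show ?thesis
    unfolding has_optimal_value_def
    using x transport_minimizer_if_flow_minimizer[OF x corr] cost_corresponds[OF corr] by blast
qed

text \<open>A minimizer costs at most as much as \<open>M0\<close>, so its own cost is not
  \<open>\<infinity>\<close> either.\<close>

lemma transport_minimizer_corresponds:
  assumes "transport_feas M0" "transport_obj M0 \<noteq> \<infinity>" "is_arg_min transport_obj transport_feas M"
  shows "corresponds M M"
proof (rule finite_cost_corresponds)
  show "transport_feas M"
    using assms(3) by (simp add: is_arg_min_def)
  show "transport_obj M \<noteq> \<infinity>"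
    using assms by (auto simp: is_arg_min_linorder)
qed

end

theorem theorem1:
  fixes N :: "'v pair_pre_digraph"
    and T :: nat
    and Src Snk :: "('v \<times> 'v) set"
    and rsrc rsnk c d :: "'v \<times> 'v \<Rightarrow> real"
  assumes "pair_fin_digraph N"
    and "2 \<le> T"
    and "Src \<subseteq> parcs N" and "Snk \<subseteq> parcs N"
    and "\<forall>e\<in>Src. 0 \<le> rsrc e" and "\<forall>e\<in>Snk. 0 \<le> rsnk e"
    and "(\<Sum>e\<in>Src. rsrc e) = (\<Sum>e\<in>Snk. rsnk e)"
    and "\<forall>e\<in>parcs N. 0 \<le> c e" and "\<forall>e\<in>parcs N. 0 \<le> d e"
  shows "((\<exists>M. transport_feasible N T Src Snk rsrc rsnk d M \<and> \<bar>transport_cost N T c M\<bar> \<noteq> \<infinity>) \<longrightarrow>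
           (\<exists>v::real.
              has_optimal_value (transport_cost N T c)
                (transport_feasible N T Src Snk rsrc rsnk d) (ereal v) \<and>
              has_optimal_value (flow_cost N T Src Snk c)
                (flow_feasible N T Src Snk rsrc rsnk d) v) \<and>
           (\<forall>M. is_arg_min (transport_cost N T c)
                  (transport_feasible N T Src Snk rsrc rsnk d) M \<longrightarrow>
              (\<exists>x. is_arg_min (flow_cost N T Src Snk c)
                     (flow_feasible N T Src Snk rsrc rsnk d) x \<and>
                   tensor_of_flow N T Src Snk M x)))
       \<and> ((\<exists>x. flow_feasible N T Src Snk rsrc rsnk d x) \<longrightarrow>
           (\<exists>v::real.
              has_optimal_value (flow_cost N T Src Snk c)
                (flow_feasible N T Src Snk rsrc rsnk d) v \<and>
              has_optimal_value (transport_cost N T c)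
                (transport_feasible N T Src Snk rsrc rsnk d) (ereal v)) \<and>
           (\<forall>x. is_arg_min (flow_cost N T Src Snk c)
                  (flow_feasible N T Src Snk rsrc rsnk d) x \<longrightarrow>
              (\<exists>M. is_arg_min (transport_cost N T c)
                     (transport_feasible N T Src Snk rsrc rsnk d) M \<and>
                   tensor_of_flow N T Src Snk M x)))"
proof -
  interpret transport_network N T Src Snk rsrc rsnk c d
    using assms by (simp add: transport_network_def transport_network_axioms_def)
  show ?thesis
  proof (intro conjI impI)
    assume "\<exists>M. transport_feas M \<and> \<bar>transport_obj M\<bar> \<noteq> \<infinity>"
    then obtain M0 where M0: "transport_feas M0" "transport_obj M0 \<noteq> \<infinity>"
      by auto
    then have "flow_feas M0"
      using finite_cost_corresponds feasible_corresponds_iff by blast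
    then show "\<exists>v::real. has_optimal_value transport_obj transport_feas (ereal v) \<and>
        has_optimal_value flow_obj flow_feas v"
      by (rule common_optimal_value)
    \<comment> \<open>The witness for \<open>x\<close> is \<open>M\<close> itself, read as a
      flow.\<close>
    show "\<forall>M. is_arg_min transport_obj transport_feas M \<longrightarrow>
        (\<exists>x. is_arg_min flow_obj flow_feas x \<and> corresponds M x)"
      using transport_minimizer_corresponds[OF M0] flow_minimizer_if_transport_minimizer by blast
  next
    assume "\<exists>x. flow_feas x"
    then show "\<exists>v::real. has_optimal_value flow_obj flow_feas v \<and>
        has_optimal_value transport_obj transport_feas (ereal v)"
      using common_optimal_value by blast
    \<comment> \<open>The witness for \<open>M\<close> is the extension of \<open>x\<close> by
      zero.\<close>
    show "\<forall>x. is_arg_min flow_obj flow_feas x \<longrightarrow>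
        (\<exists>M. is_arg_min transport_obj transport_feas M \<and> corresponds M x)"
      using transport_minimizer_if_flow_minimizer tensor_of_flow_tensor_extension by blast
  qed
qed

end
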